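(* Let $\pi \in \Pi$, let $L \ge 1$ be an integer, $\delta \in (0,1]$, $\lambda > 0$, and let $h:[0,1]^2\times[-1,0]\to(-\infty,0]$ satisfy $pc/q \le h(p,q,c) \le 0$ for all $(p,q,c)\in[0,1]^2\times[-1,0]$. Then, with probability at least $1-\delta$ over the logged data $\mathcal{D}_n$, $$R(\pi) \le \psi_\lambda\Big(\hat{R}^h_n(\pi) + \sum_{\ell=2}^{2L}\frac{\lambda^{\ell-1}}{\ell}\hat{\mathcal{M}}^{h,\ell}_n(\pi) + \frac{\ln(1/\delta)}{\lambda n}\Big).$$
   Context: Setting (offline contextual bandit). $\mathcal{X}\subset\mathbb{R}^d$ is a compact context space, $\mathcal{A}=\{1,\dots,K\}$ a finite action set, $\nu$ a probability distribution on $\mathcal{X}$. A policy $\pi$ assigns to each $x\in\mathcal{X}$ a probability distribution $\pi(\cdot|x)$ on $\mathcal{A}$; $\Pi$ is the set of policies and $\pi_0$ is a fixed behavior policy. Given $(x,a)$, a cost $c\in[-1,0]$ is drawn from a distribution $p(\cdot|x,a)$, with mean $c(x,a)$. The logged data $\mathcal{D}_n=(x_i,a_i,c_i)_{i\in[n]}$ consists of $n$ i.i.d. tuples with $x_i\sim\nu$, $a_i\sim\pi_0(\cdot|x_i)$, $c_i\sim p(\cdot|x_i,a_i)$ (so $\pi_0(a_i|x_i)>0$ almost surely). The risk of a policy is $R(\pi)=\mathbb{E}_{x\sim\nu,\,a\sim\pi(\cdot|x)}[c(x,a)]$. Notation. $h_i = h(\pi(a_i|x_i),\pi_0(a_i|x_i),c_i)$;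 $\hat{R}^h_n(\pi)=\frac1n\sum_{i=1}^n h_i$ (regularized inverse propensity scoring estimator); $\hat{\mathcal{M}}^{h,\ell}_n(\pi)=\frac1n\sum_{i=1}^n h_i^\ell$; $\psi_\lambda(x)=\frac1\lambda(1-e^{-\lambda x})$ for $x\in\mathbb{R}$. (The functions $h$ are understood to be measurable, and the condition on $h$ is only relevant for $q>0$.) *)

theory Defs
  imports "HOL-Probability.Probability"
begin

type_synonym 'x policy = "'x \<Rightarrow> nat \<Rightarrow> real"
type_synonym 'x cost_kernel = "'x \<times> nat \<Rightarrow> real measure"
type_synonym 'x log_entry = "'x \<times> nat \<times> real"

definition context_space :: "'x::topological_space set \<Rightarrow> 'x measure" where
  "context_space X = restrict_space borel X"

definition action_space :: "nat \<Rightarrow> nat measure" where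
  "action_space K = count_space {1..K}"

definition prob_range :: "real measure" where
  "prob_range = restrict_space borel {0..1}"

definition cost_range :: "real measure" where
  "cost_range = restrict_space borel {-1..0}"

definition log_space :: "'x::topological_space set \<Rightarrow> nat \<Rightarrow> 'x log_entry measure" where
  "log_space X K = context_space X \<Otimes>\<^sub>M (action_space K \<Otimes>\<^sub>M cost_range)"

text \<open>Here \<open>\<pi> x a\<close> stands for the conditional probability \<open>\<pi>(a|x)\<close>; its values outside
  \<open>X\<close> and \<open>{1..K}\<close> are irrelevant.\<close>

definition is_policy :: "'x::topological_space set \<Rightarrow> nat \<Rightarrow> 'x policy \<Rightarrow> bool" where
  "is_policy X K \<pi> \<longleftrightarrow>
     (\<forall>x\<in>X. (\<forall>a\<in>{1..K}. 0 \<le> \<pi> x a) \<and> (\<Sum>a\<in>{1..K}. \<pi> x a) = 1) \<and>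
     (\<forall>a\<in>{1..K}. (\<lambda>x. \<pi> x a) \<in> borel_measurable (context_space X))"

definition action_dist :: "nat \<Rightarrow> 'x policy \<Rightarrow> 'x \<Rightarrow> nat measure" where
  "action_dist K \<pi> x = point_measure {1..K} (\<lambda>a. ennreal (\<pi> x a))"

text \<open>Joint law of \<open>(x, a)\<close> with \<open>x \<sim> \<nu>\<close> and \<open>a \<sim> \<pi>(\<cdot>|x)\<close>.\<close>

definition context_action_law ::
  "'x::topological_space set \<Rightarrow> nat \<Rightarrow> 'x measure \<Rightarrow> 'x policy \<Rightarrow> ('x \<times> nat) measure" where
  "context_action_law X K \<nu> \<pi> =
     do { x \<leftarrow> \<nu>; a \<leftarrow> action_dist K \<pi> x;
          return (context_space X \<Otimes>\<^sub>M action_space K) (x, a) }"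

text \<open>Joint law of one logged tuple \<open>(x, a, c)\<close>, with \<open>x \<sim> \<nu>\<close>,
  \<open>a \<sim> \<pi>\<^sub>0(\<cdot>|x)\<close> and \<open>c \<sim> p(\<cdot>|x,a)\<close>.\<close>

definition logging_law ::
  "'x::topological_space set \<Rightarrow> nat \<Rightarrow> 'x measure \<Rightarrow> 'x policy \<Rightarrow> 'x cost_kernel
    \<Rightarrow> 'x log_entry measure" where
  "logging_law X K \<nu> \<pi>\<^sub>0 p =
     do { x \<leftarrow> \<nu>; a \<leftarrow> action_dist K \<pi>\<^sub>0 x; c \<leftarrow> p (x, a);
          return (log_space X K) (x, a, c) }"

definition mean_cost :: "'x cost_kernel \<Rightarrow> 'x \<times> nat \<Rightarrow> real" where
  "mean_cost p xa = (\<integral>c. c \<partial>p xa)"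

definition risk ::
  "'x::topological_space set \<Rightarrow> nat \<Rightarrow> 'x measure \<Rightarrow> 'x cost_kernel \<Rightarrow> 'x policy \<Rightarrow> real" where
  "risk X K \<nu> p \<pi> = (\<integral>xa. mean_cost p xa \<partial>context_action_law X K \<nu> \<pi>)"

type_synonym regularizer = "real \<Rightarrow> real \<Rightarrow> real \<Rightarrow> real"

definition reg_cost :: "regularizer \<Rightarrow> 'x policy \<Rightarrow> 'x policy \<Rightarrow> 'x log_entry \<Rightarrow> real" where
  "reg_cost h \<pi>\<^sub>0 \<pi> = (\<lambda>(x, a, c). h (\<pi> x a) (\<pi>\<^sub>0 x a) c)"

text \<open>The data set is \<open>D 1, \<dots>, D n\<close>.\<close>

definition emp_moment ::
  "regularizer \<Rightarrow> nat \<Rightarrow> 'x policy \<Rightarrow> nat \<Rightarrow> (nat \<Rightarrow> 'x log_entry) \<Rightarrow> 'x policy \<Rightarrow> real" where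
  "emp_moment h l \<pi>\<^sub>0 n D \<pi> = (1 / real n) * (\<Sum>i=1..n. reg_cost h \<pi>\<^sub>0 \<pi> (D i) ^ l)"

definition emp_risk ::
  "regularizer \<Rightarrow> 'x policy \<Rightarrow> nat \<Rightarrow> (nat \<Rightarrow> 'x log_entry) \<Rightarrow> 'x policy \<Rightarrow> real" where
  "emp_risk h \<pi>\<^sub>0 n D \<pi> = (1 / real n) * (\<Sum>i=1..n. reg_cost h \<pi>\<^sub>0 \<pi> (D i))"

definition psi :: "real \<Rightarrow> real \<Rightarrow> real" where
  "psi lam x = (1 / lam) * (1 - exp (- lam * x))"

text \<open>The monadic definitions above denote the intended probability laws.\<close>

lemma action_dist_measurable:
  assumes "is_policy X K \<pi>"
  shows "action_dist K \<pi> \<in> context_space X \<rightarrow>\<^sub>M prob_algebra (action_space K)"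
proof (rule measurable_prob_algebraI)
  have sp: "space (context_space X) = X"
    by (simp add: context_space_def space_restrict_space)
  have em: "emeasure (action_dist K \<pi> x) A = (\<Sum>a\<in>A. ennreal (\<pi> x a))" if "A \<subseteq> {1..K}" for x A
    unfolding action_dist_def using that by (intro emeasure_point_measure_finite) auto
  show prob: "prob_space (action_dist K \<pi> x)" if "x \<in> space (context_space X)" for x
  proof
    have x: "x \<in> X" "(\<Sum>a\<in>{1..K}. \<pi> x a) = 1" "\<And>a. a \<in> {1..K} \<Longrightarrow> 0 \<le> \<pi> x a"
      using that assms by (auto simp: sp is_policy_def)
    show "emeasure (action_dist K \<pi> x) (space (action_dist K \<pi> x)) = 1"
      using em[of "{1..K}" x] x(2) sum_ennreal[of "{1..K}" "\<pi> x", OF x(3)]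
      by (simp add: action_dist_def space_point_measure)
  qed
  show "action_dist K \<pi> \<in> context_space X \<rightarrow>\<^sub>M subprob_algebra (action_space K)"
  proof (rule measurable_subprob_algebra)
    show "subprob_space (action_dist K \<pi> x)" if "x \<in> space (context_space X)" for x
      using prob[OF that] by (rule prob_space_imp_subprob_space)
    show "sets (action_dist K \<pi> x) = sets (action_space K)" for x
      by (simp add: action_dist_def action_space_def sets_point_measure)
    fix A assume "A \<in> sets (action_space K)"
    then have A: "A \<subseteq> {1..K}" by (simp add: action_space_def)
    have "(\<lambda>x. \<Sum>a\<in>A. ennreal (\<pi> x a)) \<in> borel_measurable (context_space X)"
      using assms A
      by (intro borel_measurable_sum measurable_compose[OF _ measurable_ennreal])
         (auto simp: is_policy_def)
    then show "(\<lambda>x. emeasure (action_dist K \<pi> x) A) \<in> borel_measurable (context_space X)"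
      by (simp add: em[OF A])
  qed
qed

lemma context_action_law_prob:
  assumes "\<nu> \<in> space (prob_algebra (context_space X))" and "is_policy X K \<pi>"
  shows "context_action_law X K \<nu> \<pi> \<in> space (prob_algebra (context_space X \<Otimes>\<^sub>M action_space K))"
proof -
  note action_dist_measurable[OF assms(2), measurable]
  have "(\<lambda>\<mu>. context_action_law X K \<mu> \<pi>) \<in>
      prob_algebra (context_space X) \<rightarrow>\<^sub>M prob_algebra (context_space X \<Otimes>\<^sub>M action_space K)"
    unfolding context_action_law_def by measurable
  from measurable_space[OF this assms(1)] show ?thesis .
qed

lemma logging_law_prob:
  assumes "\<nu> \<in> space (prob_algebra (context_space X))" and "is_policy X K \<pi>\<^sub>0"
    and p [measurable]: "p \<in> context_space X \<Otimes>\<^sub>M action_space K \<rightarrow>\<^sub>M prob_algebra cost_range"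
  shows "logging_law X K \<nu> \<pi>\<^sub>0 p \<in> space (prob_algebra (log_space X K))"
proof -
  note action_dist_measurable[OF assms(2), measurable]
  have "(\<lambda>\<mu>. logging_law X K \<mu> \<pi>\<^sub>0 p) \<in>
      prob_algebra (context_space X) \<rightarrow>\<^sub>M prob_algebra (log_space X K)"
    unfolding logging_law_def log_space_def by measurable
  from measurable_space[OF this assms(1)] show ?thesis .
qed

end

theory Submission
  imports Defs
begin

text \<open>Write \<open>S\<^sub>i = \<Sum>\<^bsub>l\<le>2L\<^esub> (\<lambda> h\<^sub>i)\<^sup>l / l\<close>. The Taylor polynomials of even degree of
  \<open>- ln (1 - t)\<close> lie above it for \<open>t \<le> 0\<close>, so \<open>exp (- S\<^sub>i) \<le> 1 - \<lambda> h\<^sub>i\<close>. Since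
  \<open>h \<ge> \<pi> c / \<pi>\<^sub>0\<close>, changing measure from \<open>\<pi>\<^sub>0\<close> to \<open>\<pi>\<close> gives \<open>E h\<^sub>i \<ge> R(\<pi>)\<close>, hence
  \<open>E exp (- S\<^sub>i) \<le> 1 - \<lambda> R(\<pi>)\<close>. By independence and Markov's inequality,
  \<open>\<Prod>\<^sub>i exp (- S\<^sub>i) \<le> (1 - \<lambda> R(\<pi>))\<^sup>n / \<delta>\<close> with probability at least \<open>1 - \<delta>\<close>, and solving this
  for \<open>R(\<pi>)\<close> is exactly the claimed bound.\<close>

section \<open>Even Taylor polynomials of the logarithm\<close>

text \<open>The difference of the two sides vanishes at 0. Differentiating it gives a geometric sum
  minus \<open>1 / (1 - s)\<close>, that is \<open>- (s ^ (2*L) / (1 - s))\<close>. This is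
  nonpositive for s \<le> 0 because the exponent is even, so the difference can only grow when
  moving left from 0.\<close>

lemma neg_ln_one_minus_le_sum:
  fixes t :: real
  assumes "t \<le> 0"
  shows "- ln (1 - t) \<le> (\<Sum>l=1..2*L. t ^ l / real l)"
proof -
  define f where "f s = (\<Sum>l=1..2*L. s ^ l / real l) + ln (1 - s)" for s :: real
  have deriv: "(f has_real_derivative - (s ^ (2*L) / (1 - s))) (at s)" if "s \<le> 0" for s
  proof -
    have "(\<Sum>l=1..2*L. real l * s ^ (l - 1) / real l) = (\<Sum>l=1..2*L. s ^ (l - 1))"
      by (intro sum.cong) auto
    also have "\<dots> = (\<Sum>k<2*L. s ^ k)"
      by (rule sum.reindex_bij_witness[where i=Suc and j="\<lambda>l. l - 1"]) auto
    also have "\<dots> = (1 - s ^ (2*L)) / (1 - s)"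
      using that by (subst sum_gp_strict) auto
    finally have "(\<Sum>l=1..2*L. real l * s ^ (l - 1) / real l) - 1 / (1 - s) = - (s ^ (2*L) / (1 - s))"
      by (simp add: diff_divide_distrib)
    moreover have "(f has_real_derivative
        (\<Sum>l=1..2*L. real l * s ^ (l - 1) / real l) - 1 / (1 - s)) (at s)"
      unfolding f_def using that by (auto intro!: derivative_eq_intros sum.cong)
    ultimately show ?thesis by simp
  qed
  have "f 0 \<le> f t"
  proof (rule DERIV_nonpos_imp_nonincreasing[OF assms])
    fix s assume "t \<le> s" "s \<le> 0"
    then show "\<exists>y. (f has_real_derivative y) (at s) \<and> y \<le> 0"
      by (intro exI[of _ "- (s ^ (2*L) / (1 - s))"]) (simp add: deriv)
  qed
  moreover have "f 0 = 0"
    unfolding f_def by (auto intro!: sum.neutral)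
  ultimately show ?thesis
    by (simp add: f_def)
qed

text \<open>The point is the linear right-hand side: its expectation involves only the first moment
  of the regularized costs, although the exponent on the left contains powers up to
  \<open>2*L\<close>.\<close>

lemma exp_neg_sum_le:
  fixes t :: real
  assumes "t \<le> 0"
  shows "exp (- (\<Sum>l=1..2*L. t ^ l / real l)) \<le> 1 - t"
proof -
  have "exp (- (\<Sum>l=1..2*L. t ^ l / real l)) \<le> exp (ln (1 - t))"
    using neg_ln_one_minus_le_sum[OF assms, of L] by (subst exp_le_cancel_iff) linarith
  then show ?thesis using assms by simp
qed

section \<open>Markov's inequality for products of independent variables\<close>

text \<open>By independence the expectation of the product factorizes, so it is at most
  \<open>C ^ card I\<close>; Markov's inequality at the threshold
  \<open>C ^ card I / \<delta>\<close> then leaves a failure probability of at most \<delta>.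
  Working with \<open>nn_integral\<close> avoids integrability questions.\<close>

lemma (in prob_space) prob_prod_le_ge:
  fixes Z :: "'i \<Rightarrow> 'a \<Rightarrow> real"
  assumes I: "finite I" and indep: "indep_vars (\<lambda>_. borel) Z I"
    and nonneg: "\<And>i \<omega>. i \<in> I \<Longrightarrow> 0 \<le> Z i \<omega>"
    and le: "\<And>i. i \<in> I \<Longrightarrow> (\<integral>\<^sup>+\<omega>. ennreal (Z i \<omega>) \<partial>M) \<le> ennreal C"
    and "0 < C" "0 < \<delta>"
  shows "1 - \<delta> \<le> prob {\<omega>\<in>space M. (\<Prod>i\<in>I. Z i \<omega>) \<le> C ^ card I / \<delta>}"
proof -
  have [measurable]: "Z i \<in> borel_measurable M" if "i \<in> I" for i
    using indep that by (auto simp: indep_vars_def)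
  let ?P = "\<lambda>\<omega>. \<Prod>i\<in>I. Z i \<omega>" and ?b = "C ^ card I / \<delta>"
  have b: "0 < ?b" using assms by simp
  have [measurable]: "?P \<in> borel_measurable M" by measurable
  have "(\<integral>\<^sup>+\<omega>. ennreal (?P \<omega>) \<partial>M) = (\<integral>\<^sup>+\<omega>. (\<Prod>i\<in>I. ennreal (Z i \<omega>)) \<partial>M)"
    using nonneg by (simp add: prod_ennreal)
  also have "\<dots> = (\<Prod>i\<in>I. \<integral>\<^sup>+\<omega>. ennreal (Z i \<omega>) \<partial>M)"
    by (intro indep_vars_nn_integral I indep_vars_compose2[OF indep]) auto
  also have "\<dots> \<le> (\<Prod>i\<in>I. ennreal C)"
    using le by (intro prod_mono_ennreal)
  also have "\<dots> = ennreal (C ^ card I)"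
    using \<open>0 < C\<close> by (simp add: ennreal_power)
  finally have P: "(\<integral>\<^sup>+\<omega>. ennreal (?P \<omega>) \<partial>M) \<le> ennreal (C ^ card I)" .
  \<comment> \<open>Markov's inequality is available for events of the form
    \<open>1 \<le> c * u\<close>, so the threshold is absorbed into the factor
    \<open>1 / ?b\<close>. An inclusion suffices, and the strict bad event is chosen because its
    complement is the desired event.\<close>
  have sub: "{\<omega>\<in>space M. ?b < ?P \<omega>} \<subseteq> {\<omega>\<in>space M. 1 \<le> ennreal (1 / ?b) * ennreal (?P \<omega>)}"
  proof (intro subsetI CollectI conjI)
    fix \<omega> assume \<omega>: "\<omega> \<in> {\<omega>\<in>space M. ?b < ?P \<omega>}"
    then have "1 \<le> 1 / ?b * ?P \<omega>"
      using b by (simp only: mem_Collect_eq times_divide_eq_left mult_1_left le_divide_eq_1_pos less_imp_le)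
    then show "1 \<le> ennreal (1 / ?b) * ennreal (?P \<omega>)"
      using \<open>0 < C\<close> \<open>0 < \<delta>\<close> ennreal_leI[of 1 "1 / ?b * ?P \<omega>"] by (subst ennreal_mult'[symmetric]) auto
    from \<omega> show "\<omega> \<in> space M" by simp
  qed
  have "emeasure M {\<omega>\<in>space M. ?b < ?P \<omega>} \<le>
      emeasure M {\<omega>\<in>space M. 1 \<le> ennreal (1 / ?b) * ennreal (?P \<omega>)}"
    by (rule emeasure_mono[OF sub]) measurable
  also have "\<dots> \<le> ennreal (1 / ?b) * (\<integral>\<^sup>+\<omega>. ennreal (?P \<omega>) \<partial>M)"
    using nn_integral_Markov_inequality[of "\<lambda>\<omega>. ennreal (?P \<omega>)" "space M" M "ennreal (1 / ?b)"]
    by (simp cong: nn_integral_cong)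
  also have "\<dots> \<le> ennreal (1 / ?b) * ennreal (C ^ card I)"
    using P by (rule mult_left_mono) simp
  also have "\<dots> = ennreal \<delta>"
    using \<open>0 < C\<close> \<open>0 < \<delta>\<close> by (simp flip: ennreal_mult)
  finally have "prob {\<omega>\<in>space M. ?b < ?P \<omega>} \<le> \<delta>"
    using \<open>0 < \<delta>\<close> by (simp add: emeasure_eq_measure)
  moreover have "{\<omega>\<in>space M. ?P \<omega> \<le> ?b} = space M - {\<omega>\<in>space M. ?b < ?P \<omega>}"
    by auto
  then have "prob {\<omega>\<in>space M. ?P \<omega> \<le> ?b} = 1 - prob {\<omega>\<in>space M. ?b < ?P \<omega>}"
    by (simp add: prob_compl)
  ultimately show ?thesis by simp
qed

section \<open>Equivalence of the risk bound with a product inequality\<close>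

text \<open>Inverting \<open>psi\<close> turns the bound into
  \<open>exp (- lam * ?T) \<le> 1 - lam * R\<close>. Since \<open>lam * ?T\<close> is an average
  over the sample plus a confidence term, the n-th power of the left side is the product of the
  per-sample exponentials times \<delta>.\<close>

lemma risk_le_psi_iff:
  assumes n: "n \<ge> 1" and L: "L \<ge> 1" and "0 < \<delta>" "0 < lam" "R \<le> 0"
  shows "R \<le> psi lam (emp_risk h \<pi>\<^sub>0 n D \<pi>
                + (\<Sum>l=2..2 * L. lam ^ (l - 1) / real l * emp_moment h l \<pi>\<^sub>0 n D \<pi>)
                + ln (1 / \<delta>) / (lam * real n)) \<longleftrightarrow>
         (\<Prod>i=1..n. exp (- (\<Sum>l=1..2*L. (lam * reg_cost h \<pi>\<^sub>0 \<pi> (D i)) ^ l / real l)))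
           \<le> (1 - lam * R) ^ n / \<delta>"
    (is "_ \<le> psi lam ?T \<longleftrightarrow> ?P \<le> _")
proof -
  define y where "y i = reg_cost h \<pi>\<^sub>0 \<pi> (D i)" for i
  define S where "S = (\<Sum>i=1..n. \<Sum>l=1..2*L. (lam * y i) ^ l / real l)"
  have moment: "lam * (lam ^ (l - 1) / real l * emp_moment h l \<pi>\<^sub>0 n D \<pi>)
      = (\<Sum>i=1..n. (lam * y i) ^ l / real l) / real n" if "l \<ge> 1" for l
  proof -
    have "lam * (lam ^ (l - 1) / real l * emp_moment h l \<pi>\<^sub>0 n D \<pi>)
        = lam ^ l * (\<Sum>i=1..n. y i ^ l) / real l / real n"
      using that by (simp add: emp_moment_def y_def power_eq_if)
    then show ?thesis
      by (simp add: power_mult_distrib sum_distrib_left sum_divide_distrib)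
  qed
  \<comment> \<open>The empirical risk is the missing summand with index 1 of the moment sum;
    \<open>L \<ge> 1\<close> makes that index lie in the range.\<close>
  have "lam * (emp_risk h \<pi>\<^sub>0 n D \<pi>
        + (\<Sum>l=2..2*L. lam ^ (l - 1) / real l * emp_moment h l \<pi>\<^sub>0 n D \<pi>))
      = lam * (\<Sum>l=1..2*L. lam ^ (l - 1) / real l * emp_moment h l \<pi>\<^sub>0 n D \<pi>)"
    using L by (subst (2) sum.atLeast_Suc_atMost)
      (auto simp: emp_risk_def emp_moment_def numeral_2_eq_2)
  also have "\<dots> = (\<Sum>l=1..2*L. \<Sum>i=1..n. (lam * y i) ^ l / real l) / real n"
    by (simp only: sum_distrib_left sum_divide_distrib[where A="{1..2*L}"])
      (intro sum.cong refl moment, simp)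
  also have "\<dots> = S / real n"
    unfolding S_def by (subst sum.swap) simp
  finally have T: "lam * ?T = S / real n + ln (1 / \<delta>) / real n"
    using \<open>0 < lam\<close> by (simp add: distrib_left)
  have "exp (- lam * ?T) ^ n = exp (- (real n * (lam * ?T)))"
    by (simp flip: exp_of_nat_mult)
  also have "real n * (lam * ?T) = S + ln (1 / \<delta>)"
    unfolding T using n by (simp add: distrib_left)
  also have "exp (- (S + ln (1 / \<delta>))) = exp (- S) * \<delta>"
    using \<open>0 < \<delta>\<close> by (simp add: exp_add exp_diff exp_minus ln_div field_simps)
  also have "exp (- S) = ?P"
    by (simp add: S_def y_def sum_negf[symmetric] exp_sum)
  finally have E: "exp (- lam * ?T) ^ n = ?P * \<delta>" .
  \<comment> \<open>Nonnegativity of both sides makes the passage to n-th powers below an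
    equivalence; this is where the sign of \<open>R\<close> enters.\<close>
  have "0 \<le> 1 - lam * R"
    using \<open>0 < lam\<close> \<open>R \<le> 0\<close> mult_nonneg_nonpos[of lam R] by linarith
  have "R \<le> psi lam ?T \<longleftrightarrow> exp (- lam * ?T) \<le> 1 - lam * R"
    using \<open>0 < lam\<close> unfolding psi_def by (auto simp: field_simps)
  also have "\<dots> \<longleftrightarrow> exp (- lam * ?T) ^ n \<le> (1 - lam * R) ^ n"
    using n \<open>0 \<le> 1 - lam * R\<close> by (subst power_mono_iff) auto
  also have "\<dots> \<longleftrightarrow> ?P \<le> (1 - lam * R) ^ n / \<delta>"
    unfolding E using \<open>0 < \<delta>\<close> by (simp add: pos_le_divide_eq)
  finally show ?thesis .
qed

section \<open>Integration against the sampling laws\<close>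

lemma nn_integral_action_dist:
  "(\<integral>\<^sup>+a. f a \<partial>action_dist K \<pi> x) = (\<Sum>a\<in>{1..K}. ennreal (\<pi> x a) * f a)"
  unfolding action_dist_def by (subst nn_integral_point_measure_finite) (auto simp: mult.commute)

lemma space_context_space [simp]: "space (context_space X) = X"
  by (simp add: context_space_def space_restrict_space)

lemma space_action_space [simp]: "space (action_space K) = {1..K}"
  by (simp add: action_space_def)

lemma space_cost_range [simp]: "space cost_range = {-1..0}"
  by (simp add: cost_range_def space_restrict_space)

lemma borel_measurable_cost_range [measurable]: "(\<lambda>c. c) \<in> borel_measurable cost_range"
  unfolding cost_range_def by (rule measurable_restrict_space1) simp

text \<open>Here and for the logging law, the monadic definition is unfolded into one integral over
  contexts of a finite sum over actions, so that two policies can be compared action by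
  action.\<close>

lemma nn_integral_context_action_law:
  assumes \<nu>: "\<nu> \<in> space (prob_algebra (context_space X))" and \<pi>: "is_policy X K \<pi>"
    and f [measurable]: "f \<in> borel_measurable (context_space X \<Otimes>\<^sub>M action_space K)"
  shows "(\<integral>\<^sup>+xa. f xa \<partial>context_action_law X K \<nu> \<pi>) =
         (\<integral>\<^sup>+x. (\<Sum>a\<in>{1..K}. ennreal (\<pi> x a) * f (x, a)) \<partial>\<nu>)"
proof -
  note action_dist_measurable[OF \<pi>, measurable]
  have sets [measurable_cong]: "sets \<nu> = sets (context_space X)"
    using \<nu> by (simp add: space_prob_algebra)
  have sp: "space \<nu> = X"
    using sets_eq_imp_space_eq[OF sets] by simp
  have "(\<lambda>x. action_dist K \<pi> x \<bind> (\<lambda>a. return (context_space X \<Otimes>\<^sub>M action_space K) (x, a)))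
      \<in> \<nu> \<rightarrow>\<^sub>M prob_algebra (context_space X \<Otimes>\<^sub>M action_space K)"
    by measurable
  then have "(\<integral>\<^sup>+xa. f xa \<partial>context_action_law X K \<nu> \<pi>) = (\<integral>\<^sup>+x. \<integral>\<^sup>+xa. f xa \<partial>(action_dist K \<pi> x \<bind>
      (\<lambda>a. return (context_space X \<Otimes>\<^sub>M action_space K) (x, a))) \<partial>\<nu>)"
    unfolding context_action_law_def
    by (intro nn_integral_bind[OF f] measurable_prob_algebraD)
  also have "\<dots> = (\<integral>\<^sup>+x. \<integral>\<^sup>+a. f (x, a) \<partial>action_dist K \<pi> x \<partial>\<nu>)"
  proof (rule nn_integral_cong)
    fix x assume "x \<in> space \<nu>"
    then have x: "x \<in> space (context_space X)" by (simp add: sp)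
    have s [measurable_cong]: "sets (action_dist K \<pi> x) = sets (action_space K)"
      by (simp add: action_dist_def action_space_def sets_point_measure)
    have "(\<integral>\<^sup>+xa. f xa \<partial>(action_dist K \<pi> x \<bind> (\<lambda>a. return (context_space X \<Otimes>\<^sub>M action_space K) (x, a))))
       = (\<integral>\<^sup>+a. \<integral>\<^sup>+xa. f xa \<partial>return (context_space X \<Otimes>\<^sub>M action_space K) (x, a) \<partial>action_dist K \<pi> x)"
      using x by (intro nn_integral_bind[OF f]) measurable
    also have "\<dots> = (\<integral>\<^sup>+a. f (x, a) \<partial>action_dist K \<pi> x)"
      using x by (intro nn_integral_cong nn_integral_return f)
        (auto simp: space_pair_measure action_dist_def space_point_measure)
    finally show "(\<integral>\<^sup>+xa. f xa \<partial>(action_dist K \<pi> x \<bind> (\<lambda>a. return (context_space X \<Otimes>\<^sub>M action_space K) (x, a))))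
       = (\<integral>\<^sup>+a. f (x, a) \<partial>action_dist K \<pi> x)" .
  qed
  finally show ?thesis
    by (simp add: nn_integral_action_dist)
qed

text \<open>The three nested binds are peeled off by \<open>nn_integral_bind\<close>, which needs
  each kernel to be measurable; the final \<open>return\<close> evaluates the integrand at the
  sampled tuple.\<close>

lemma nn_integral_logging_law:
  assumes \<nu>: "\<nu> \<in> space (prob_algebra (context_space X))" and \<pi>\<^sub>0: "is_policy X K \<pi>\<^sub>0"
    and p [measurable]: "p \<in> context_space X \<Otimes>\<^sub>M action_space K \<rightarrow>\<^sub>M prob_algebra cost_range"
    and f: "f \<in> borel_measurable (log_space X K)"
  shows "(\<integral>\<^sup>+z. f z \<partial>logging_law X K \<nu> \<pi>\<^sub>0 p) =
         (\<integral>\<^sup>+x. (\<Sum>a\<in>{1..K}. ennreal (\<pi>\<^sub>0 x a) * (\<integral>\<^sup>+c. f (x, a, c) \<partial>p (x, a))) \<partial>\<nu>)"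
proof -
  note action_dist_measurable[OF \<pi>\<^sub>0, measurable]
  have sets [measurable_cong]: "sets \<nu> = sets (context_space X)"
    using \<nu> by (simp add: space_prob_algebra)
  have sp: "space \<nu> = X"
    using sets_eq_imp_space_eq[OF sets] by simp
  have ret [measurable]: "return (log_space X K) \<in>
      context_space X \<Otimes>\<^sub>M (action_space K \<Otimes>\<^sub>M cost_range) \<rightarrow>\<^sub>M prob_algebra (log_space X K)"
    unfolding log_space_def by measurable
  let ?r = "\<lambda>x a c. return (log_space X K) (x, a, c)"
  have "(\<lambda>x. action_dist K \<pi>\<^sub>0 x \<bind> (\<lambda>a. p (x, a) \<bind> ?r x a))
      \<in> \<nu> \<rightarrow>\<^sub>M prob_algebra (log_space X K)"
    by measurable
  then have "(\<integral>\<^sup>+z. f z \<partial>logging_law X K \<nu> \<pi>\<^sub>0 p) =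
      (\<integral>\<^sup>+x. \<integral>\<^sup>+z. f z \<partial>(action_dist K \<pi>\<^sub>0 x \<bind> (\<lambda>a. p (x, a) \<bind> ?r x a)) \<partial>\<nu>)"
    unfolding logging_law_def
    by (intro nn_integral_bind[OF f] measurable_prob_algebraD)
  also have "\<dots> = (\<integral>\<^sup>+x. \<integral>\<^sup>+a. \<integral>\<^sup>+c. f (x, a, c) \<partial>p (x, a) \<partial>action_dist K \<pi>\<^sub>0 x \<partial>\<nu>)"
  proof (rule nn_integral_cong)
    fix x assume "x \<in> space \<nu>"
    then have x [measurable]: "x \<in> space (context_space X)" by (simp add: sp)
    have s [measurable_cong]: "sets (action_dist K \<pi>\<^sub>0 x) = sets (action_space K)"
      by (simp add: action_dist_def action_space_def sets_point_measure)
    have inner: "(\<integral>\<^sup>+z. f z \<partial>(p (x, a) \<bind> ?r x a)) = (\<integral>\<^sup>+c. f (x, a, c) \<partial>p (x, a))"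
      if "a \<in> space (action_dist K \<pi>\<^sub>0 x)" for a
    proof -
      have a [measurable]: "a \<in> space (action_space K)"
        using that by (simp add: action_dist_def space_point_measure)
      \<comment> \<open>The sigma-algebra of \<open>p (x, a)\<close> is known only for a genuine
        context and action, so it has to be fixed here before measurability of the innermost kernel
        can be derived.\<close>
      have "p (x, a) \<in> space (prob_algebra cost_range)"
        using measurable_space[OF p] x a by (simp add: space_pair_measure)
      then have s [measurable_cong]: "sets (p (x, a)) = sets cost_range"
        by (simp add: space_prob_algebra)
      have "?r x a \<in> p (x, a) \<rightarrow>\<^sub>M prob_algebra (log_space X K)"
        by measurable
      then have "(\<integral>\<^sup>+z. f z \<partial>(p (x, a) \<bind> ?r x a)) = (\<integral>\<^sup>+c. \<integral>\<^sup>+z. f z \<partial>?r x a c \<partial>p (x, a))"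
        by (intro nn_integral_bind[OF f] measurable_prob_algebraD)
      also have "\<dots> = (\<integral>\<^sup>+c. f (x, a, c) \<partial>p (x, a))"
        using x a sets_eq_imp_space_eq[OF s] by (intro nn_integral_cong nn_integral_return f)
          (auto simp: space_pair_measure log_space_def)
      finally show ?thesis .
    qed
    have "(\<lambda>a. p (x, a) \<bind> ?r x a) \<in> action_dist K \<pi>\<^sub>0 x \<rightarrow>\<^sub>M prob_algebra (log_space X K)"
      by measurable
    then have "(\<integral>\<^sup>+z. f z \<partial>(action_dist K \<pi>\<^sub>0 x \<bind> (\<lambda>a. p (x, a) \<bind> ?r x a)))
       = (\<integral>\<^sup>+a. \<integral>\<^sup>+z. f z \<partial>(p (x, a) \<bind> ?r x a) \<partial>action_dist K \<pi>\<^sub>0 x)"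
      by (intro nn_integral_bind[OF f] measurable_prob_algebraD)
    also have "\<dots> = (\<integral>\<^sup>+a. \<integral>\<^sup>+c. f (x, a, c) \<partial>p (x, a) \<partial>action_dist K \<pi>\<^sub>0 x)"
      by (intro nn_integral_cong inner)
    finally show "(\<integral>\<^sup>+z. f z \<partial>(action_dist K \<pi>\<^sub>0 x \<bind> (\<lambda>a. p (x, a) \<bind> ?r x a)))
       = (\<integral>\<^sup>+a. \<integral>\<^sup>+c. f (x, a, c) \<partial>p (x, a) \<partial>action_dist K \<pi>\<^sub>0 x)" .
  qed
  finally show ?thesis
    by (simp add: nn_integral_action_dist)
qed


section \<open>Measurability of policies and regularized costs\<close>

lemma is_policy_unit_interval:
  assumes "is_policy X K \<pi>" "x \<in> X" "a \<in> {1..K}"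
  shows "\<pi> x a \<in> {0..1}"
proof -
  have nonneg: "\<forall>b\<in>{1..K}. 0 \<le> \<pi> x b" and one: "(\<Sum>b\<in>{1..K}. \<pi> x b) = 1"
    using assms by (auto simp: is_policy_def)
  have "\<pi> x a \<le> (\<Sum>b\<in>{1..K}. \<pi> x b)"
    using assms nonneg by (intro member_le_sum) auto
  with nonneg one assms show ?thesis by simp
qed

lemma measurable_policy:
  assumes "is_policy X K \<pi>"
  shows "(\<lambda>(x, a). \<pi> x a) \<in> context_space X \<Otimes>\<^sub>M action_space K \<rightarrow>\<^sub>M prob_range"
  unfolding prob_range_def
proof (rule measurable_restrict_space2)
  show "(\<lambda>(x, a). \<pi> x a) \<in> space (context_space X \<Otimes>\<^sub>M action_space K) \<rightarrow> {0..1}"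
    using is_policy_unit_interval[OF assms] by (auto simp: space_pair_measure)
  have [measurable]: "(\<lambda>x. \<pi> x a) \<in> borel_measurable (context_space X)" if "a \<in> {1..K}" for a
    using assms that by (simp add: is_policy_def)
  \<comment> \<open>The action set is countable and discrete, so joint measurability reduces to
    measurability in the context for each fixed action.\<close>
  have "(\<lambda>xa. \<pi> (fst xa) (snd xa)) \<in> borel_measurable (context_space X \<Otimes>\<^sub>M count_space {1..K})"
    by (rule measurable_compose_countable'[where g=snd and I="{1..K}"]) auto
  then show "(\<lambda>(x, a). \<pi> x a) \<in> borel_measurable (context_space X \<Otimes>\<^sub>M action_space K)"
    by (simp add: action_space_def case_prod_unfold)
qed

lemma measurable_reg_cost:
  assumes \<pi>\<^sub>0: "is_policy X K \<pi>\<^sub>0" and \<pi>: "is_policy X K \<pi>"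
    and h [measurable]: "(\<lambda>(u, q, c). h u q c) \<in>
      borel_measurable (prob_range \<Otimes>\<^sub>M (prob_range \<Otimes>\<^sub>M cost_range))"
  shows "reg_cost h \<pi>\<^sub>0 \<pi> \<in> borel_measurable (log_space X K)"
proof -
  note measurable_policy[OF \<pi>\<^sub>0, measurable] measurable_policy[OF \<pi>, measurable]
  \<comment> \<open>The unreduced applications keep both policies in the uncurried form covered by
    \<open>measurable_policy\<close>.\<close>
  have "(\<lambda>(x, a, c). ((\<lambda>(x, a). \<pi> x a) (x, a), (\<lambda>(x, a). \<pi>\<^sub>0 x a) (x, a), c))
      \<in> log_space X K \<rightarrow>\<^sub>M prob_range \<Otimes>\<^sub>M (prob_range \<Otimes>\<^sub>M cost_range)"
    unfolding log_space_def by measurable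
  from measurable_compose[OF this h] show ?thesis
    by (simp add: reg_cost_def case_prod_unfold)
qed

section \<open>Change of measure from the behavior policy to the target policy\<close>

context
  fixes X :: "'x::topological_space set" and K :: nat and p :: "'x cost_kernel"
  assumes p [measurable]: "p \<in> context_space X \<Otimes>\<^sub>M action_space K \<rightarrow>\<^sub>M prob_algebra cost_range"
begin

lemma cost_kernel_props:
  assumes "x \<in> X" "a \<in> {1..K}"
  shows "prob_space (p (x, a))" "sets (p (x, a)) = sets cost_range" "space (p (x, a)) = {-1..0}"
proof -
  have "p (x, a) \<in> space (prob_algebra cost_range)"
    using measurable_space[OF p] assms by (simp add: space_pair_measure)
  then show "prob_space (p (x, a))" and s: "sets (p (x, a)) = sets cost_range"
    by (auto simp: space_prob_algebra)
  show "space (p (x, a)) = {-1..0}"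
    using sets_eq_imp_space_eq[OF s] by simp
qed

text \<open>Costs are bounded, hence integrable, so \<open>mean_cost\<close> is a true mean and not
  the default value 0. Negation makes them nonnegative, which allows all later estimates to use
  \<open>nn_integral\<close>.\<close>

lemma nn_integral_neg_cost:
  assumes "x \<in> X" "a \<in> {1..K}"
  shows "(\<integral>\<^sup>+c. ennreal (- c) \<partial>p (x, a)) = ennreal (- mean_cost p (x, a))"
    and "mean_cost p (x, a) \<in> {-1..0}"
proof -
  interpret prob_space "p (x, a)" using cost_kernel_props[OF assms] by simp
  note [measurable_cong] = cost_kernel_props(2)[OF assms]
  have AE: "AE c in p (x, a). c \<in> {-1..0}"
    using AE_space[of "p (x, a)"] by (simp add: cost_kernel_props(3)[OF assms])
  have int: "integrable (p (x, a)) (\<lambda>c. c)"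
    using AE by (intro integrable_const_bound[where B=1]) auto
  show "(\<integral>\<^sup>+c. ennreal (- c) \<partial>p (x, a)) = ennreal (- mean_cost p (x, a))"
    using int AE by (subst nn_integral_eq_integral) (auto simp: mean_cost_def)
  have "mean_cost p (x, a) \<le> 0"
    unfolding mean_cost_def using int AE by (intro integral_le_const) auto
  moreover have "-1 \<le> mean_cost p (x, a)"
    unfolding mean_cost_def using int AE by (intro integral_ge_const) auto
  ultimately show "mean_cost p (x, a) \<in> {-1..0}" by simp
qed

lemma measurable_mean_cost [measurable]:
  "mean_cost p \<in> borel_measurable (context_space X \<Otimes>\<^sub>M action_space K)"
proof -
  have "(\<lambda>M. \<integral>c. c \<partial>M) \<in> subprob_algebra cost_range \<rightarrow>\<^sub>M (borel :: real measure)"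
    by measurable
  from measurable_compose[OF measurable_prob_algebraD[OF p] this] show ?thesis
    by (simp add: mean_cost_def[abs_def])
qed

text \<open>The same passage for the joint law of context and action. The sign of the risk is
  recorded because it makes \<open>1 - lam * risk\<close> positive in the final argument.\<close>

lemma nn_integral_neg_mean_cost:
  assumes \<nu>: "\<nu> \<in> space (prob_algebra (context_space X))" and \<pi>: "is_policy X K \<pi>"
  shows "(\<integral>\<^sup>+xa. ennreal (- mean_cost p xa) \<partial>context_action_law X K \<nu> \<pi>)
      = ennreal (- risk X K \<nu> p \<pi>)"
    and "risk X K \<nu> p \<pi> \<le> 0"
proof -
  let ?N = "context_action_law X K \<nu> \<pi>"
  have N: "?N \<in> space (prob_algebra (context_space X \<Otimes>\<^sub>M action_space K))"
    by (rule context_action_law_prob[OF \<nu> \<pi>])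
  then have s [measurable_cong]: "sets ?N = sets (context_space X \<Otimes>\<^sub>M action_space K)"
    by (simp add: space_prob_algebra)
  interpret prob_space ?N using N by (simp add: space_prob_algebra)
  have AE: "AE xa in ?N. mean_cost p xa \<in> {-1..0}"
    using nn_integral_neg_cost(2) sets_eq_imp_space_eq[OF s]
    by (intro AE_I2) (auto simp: space_pair_measure)
  have int: "integrable ?N (mean_cost p)"
    using AE by (intro integrable_const_bound[where B=1]) auto
  show "(\<integral>\<^sup>+xa. ennreal (- mean_cost p xa) \<partial>?N) = ennreal (- risk X K \<nu> p \<pi>)"
    using int AE by (subst nn_integral_eq_integral) (auto simp: risk_def)
  show "risk X K \<nu> p \<pi> \<le> 0"
    unfolding risk_def using int AE by (intro integral_le_const) auto
qed

text \<open>Importance weighting: multiplying \<open>u * c / q \<le> h u q c\<close> by the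
  propensity \<open>q\<close> cancels the denominator and leaves the target weight \<open>u\<close>.
  Actions never logged can add only to the right-hand side, so the inequality requires no absolute
  continuity of the target policy.\<close>

lemma nn_integral_neg_reg_cost_le:
  assumes \<nu>: "\<nu> \<in> space (prob_algebra (context_space X))"
    and \<pi>\<^sub>0: "is_policy X K \<pi>\<^sub>0" and \<pi>: "is_policy X K \<pi>"
    and h: "(\<lambda>(u, q, c). h u q c) \<in>
      borel_measurable (prob_range \<Otimes>\<^sub>M (prob_range \<Otimes>\<^sub>M cost_range))"
    and ge: "\<forall>u\<in>{0..1}. \<forall>q\<in>{0<..1}. \<forall>c\<in>{-1..0}. u * c / q \<le> h u q c"
  shows "(\<integral>\<^sup>+z. ennreal (- reg_cost h \<pi>\<^sub>0 \<pi> z) \<partial>logging_law X K \<nu> \<pi>\<^sub>0 p)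
      \<le> ennreal (- risk X K \<nu> p \<pi>)"
proof -
  note rc [measurable] = measurable_reg_cost[OF \<pi>\<^sub>0 \<pi> h]
  have sp: "space \<nu> = X"
    using \<nu> sets_eq_imp_space_eq[of \<nu> "context_space X"] by (simp add: space_prob_algebra)
  have le: "ennreal (\<pi>\<^sub>0 x a) * (\<integral>\<^sup>+c. ennreal (- reg_cost h \<pi>\<^sub>0 \<pi> (x, a, c)) \<partial>p (x, a))
      \<le> ennreal (\<pi> x a) * ennreal (- mean_cost p (x, a))" if x: "x \<in> X" and a: "a \<in> {1..K}" for x a
  proof -
    note s [measurable_cong] = cost_kernel_props(2)[OF x a]
    have xa [measurable]: "x \<in> space (context_space X)" "a \<in> space (action_space K)"
      using x a by auto
    have "(\<lambda>c. (x, a, c)) \<in> p (x, a) \<rightarrow>\<^sub>M log_space X K"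
      unfolding log_space_def by measurable
    from measurable_compose[OF this rc]
    have [measurable]: "(\<lambda>c. reg_cost h \<pi>\<^sub>0 \<pi> (x, a, c)) \<in> borel_measurable (p (x, a))" .
    have [measurable]: "(\<lambda>c. c) \<in> borel_measurable (p (x, a))" by measurable
    have u: "\<pi> x a \<in> {0..1}" and q: "\<pi>\<^sub>0 x a \<in> {0..1}"
      using is_policy_unit_interval \<pi> \<pi>\<^sub>0 x a by blast+
    have "ennreal (\<pi>\<^sub>0 x a) * (\<integral>\<^sup>+c. ennreal (- reg_cost h \<pi>\<^sub>0 \<pi> (x, a, c)) \<partial>p (x, a))
        = (\<integral>\<^sup>+c. ennreal (\<pi>\<^sub>0 x a) * ennreal (- reg_cost h \<pi>\<^sub>0 \<pi> (x, a, c)) \<partial>p (x, a))"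
      by (intro nn_integral_cmult[symmetric]) measurable
    also have "\<dots> \<le> (\<integral>\<^sup>+c. ennreal (\<pi> x a) * ennreal (- c) \<partial>p (x, a))"
    proof (rule nn_integral_mono)
      fix c assume "c \<in> space (p (x, a))"
      then have c: "c \<in> {-1..0}" using cost_kernel_props(3)[OF x a] by simp
      have "\<pi>\<^sub>0 x a * (- h (\<pi> x a) (\<pi>\<^sub>0 x a) c) \<le> \<pi> x a * (- c)"
      proof (cases "\<pi>\<^sub>0 x a = 0")
        case True
        then show ?thesis using u c by (simp add: mult_nonneg_nonpos)
      next
        case False
        with q have "\<pi>\<^sub>0 x a \<in> {0<..1}" by auto
        then have "\<pi> x a * c / \<pi>\<^sub>0 x a \<le> h (\<pi> x a) (\<pi>\<^sub>0 x a) c" and "0 < \<pi>\<^sub>0 x a"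
          using ge u c by auto
        then show ?thesis by (simp add: pos_divide_le_eq mult.commute)
      qed
      then have "ennreal (\<pi>\<^sub>0 x a * (- h (\<pi> x a) (\<pi>\<^sub>0 x a) c)) \<le> ennreal (\<pi> x a * (- c))"
        by (rule ennreal_leI)
      then show "ennreal (\<pi>\<^sub>0 x a) * ennreal (- reg_cost h \<pi>\<^sub>0 \<pi> (x, a, c)) \<le> ennreal (\<pi> x a) * ennreal (- c)"
        using u q by (simp only: reg_cost_def prod.case atLeastAtMost_iff ennreal_mult'[symmetric])
    qed
    also have "\<dots> = ennreal (\<pi> x a) * (\<integral>\<^sup>+c. ennreal (- c) \<partial>p (x, a))"
      by (intro nn_integral_cmult) measurable
    also have "\<dots> = ennreal (\<pi> x a) * ennreal (- mean_cost p (x, a))"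
      using nn_integral_neg_cost(1)[OF x a] by simp
    finally show ?thesis .
  qed
  have "(\<integral>\<^sup>+z. ennreal (- reg_cost h \<pi>\<^sub>0 \<pi> z) \<partial>logging_law X K \<nu> \<pi>\<^sub>0 p)
      = (\<integral>\<^sup>+x. (\<Sum>a\<in>{1..K}. ennreal (\<pi>\<^sub>0 x a) *
          (\<integral>\<^sup>+c. ennreal (- reg_cost h \<pi>\<^sub>0 \<pi> (x, a, c)) \<partial>p (x, a))) \<partial>\<nu>)"
    by (intro nn_integral_logging_law[OF \<nu> \<pi>\<^sub>0 p]) measurable
  also have "\<dots> \<le> (\<integral>\<^sup>+x. (\<Sum>a\<in>{1..K}. ennreal (\<pi> x a) * ennreal (- mean_cost p (x, a))) \<partial>\<nu>)"
    by (intro nn_integral_mono sum_mono le) (auto simp: sp)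
  also have "\<dots> = (\<integral>\<^sup>+xa. ennreal (- mean_cost p xa) \<partial>context_action_law X K \<nu> \<pi>)"
    by (intro nn_integral_context_action_law[OF \<nu> \<pi>, symmetric]) measurable
  also have "\<dots> = ennreal (- risk X K \<nu> p \<pi>)"
    by (rule nn_integral_neg_mean_cost[OF \<nu> \<pi>])
  finally show ?thesis .
qed

end

section \<open>The high-probability risk bound\<close>

theorem proposition1:
  fixes X :: "(real ^ 'd) set"
    and K n L :: nat
    and \<nu> :: "(real ^ 'd) measure"
    and \<pi>\<^sub>0 \<pi> :: "(real ^ 'd) policy"
    and p :: "(real ^ 'd) cost_kernel"
    and M :: "'w measure"
    and D :: "nat \<Rightarrow> 'w \<Rightarrow> (real ^ 'd) log_entry"
    and h :: "real \<Rightarrow> real \<Rightarrow> real \<Rightarrow> real"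
    and lam \<delta> :: real
  assumes "compact X"
    and "\<nu> \<in> space (prob_algebra (context_space X))"
    and "is_policy X K \<pi>\<^sub>0"
    and "p \<in> context_space X \<Otimes>\<^sub>M action_space K \<rightarrow>\<^sub>M prob_algebra cost_range"
    and "prob_space M"
    and "n \<ge> 1"
    and "prob_space.indep_vars M (\<lambda>_. log_space X K) D {1..n}"
    and "\<forall>i\<in>{1..n}. distr M (log_space X K) (D i) = logging_law X K \<nu> \<pi>\<^sub>0 p"
    and "is_policy X K \<pi>"
    and "L \<ge> 1"
    and "\<delta> \<in> {0<..1}"
    and "lam > 0"
    and "(\<lambda>(u, q, c). h u q c) \<in> borel_measurable (prob_range \<Otimes>\<^sub>M (prob_range \<Otimes>\<^sub>M cost_range))"
    and "\<forall>u\<in>{0..1}. \<forall>q\<in>{0..1}. \<forall>c\<in>{-1..0}. h u q c \<le> 0"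
    and "\<forall>u\<in>{0..1}. \<forall>q\<in>{0<..1}. \<forall>c\<in>{-1..0}. u * c / q \<le> h u q c"
  shows "measure M {\<omega> \<in> space M.
            risk X K \<nu> p \<pi> \<le>
              psi lam (emp_risk h \<pi>\<^sub>0 n (\<lambda>i. D i \<omega>) \<pi>
                + (\<Sum>l=2..2 * L. lam ^ (l - 1) / real l * emp_moment h l \<pi>\<^sub>0 n (\<lambda>i. D i \<omega>) \<pi>)
                + ln (1 / \<delta>) / (lam * real n))} \<ge> 1 - \<delta>"
proof -
  note \<nu> = assms(2) and \<pi>\<^sub>0 = assms(3) and p = assms(4) and n = assms(6) and indep = assms(7)
    and law = assms(8) and \<pi> = assms(9) and L = assms(10) and lam = assms(12) and h = assms(13)
    and h_le = assms(14) and h_ge = assms(15)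
  have \<delta>: "0 < \<delta>" using assms(11) by simp
  interpret prob_space M by fact
  let ?R = "risk X K \<nu> p \<pi>"
  \<comment> \<open>\<open>g\<close> is the contribution of one logged tuple to the product in
    \<open>risk_le_psi_iff\<close>.\<close>
  define g where "g z = exp (- (\<Sum>l=1..2*L. (lam * reg_cost h \<pi>\<^sub>0 \<pi> z) ^ l / real l))" for z
  have R: "?R \<le> 0" by (rule nn_integral_neg_mean_cost(2)[OF p \<nu> \<pi>])
  note rc [measurable] = measurable_reg_cost[OF \<pi>\<^sub>0 \<pi> h]
  have [measurable]: "g \<in> borel_measurable (log_space X K)"
    unfolding g_def by measurable
  let ?Q = "logging_law X K \<nu> \<pi>\<^sub>0 p"
  have Q: "prob_space ?Q" and sets_Q [measurable_cong]: "sets ?Q = sets (log_space X K)"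
    using logging_law_prob[OF \<nu> \<pi>\<^sub>0 p] by (auto simp: space_prob_algebra)
  have rc_le: "reg_cost h \<pi>\<^sub>0 \<pi> z \<le> 0" if "z \<in> space ?Q" for z
    using that is_policy_unit_interval[OF \<pi>] is_policy_unit_interval[OF \<pi>\<^sub>0] h_le
    unfolding sets_eq_imp_space_eq[OF sets_Q]
    by (auto simp: log_space_def space_pair_measure reg_cost_def)
  \<comment> \<open>The expectation of one factor is bounded by the linear estimate, taken
    pointwise, followed by the change of measure; the result is the constant \<open>C\<close> for
    the Markov bound.\<close>
  have "(\<integral>\<^sup>+z. ennreal (g z) \<partial>?Q)
      \<le> (\<integral>\<^sup>+z. 1 + ennreal lam * ennreal (- reg_cost h \<pi>\<^sub>0 \<pi> z) \<partial>?Q)"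
  proof (rule nn_integral_mono)
    fix z assume "z \<in> space ?Q"
    then have y: "reg_cost h \<pi>\<^sub>0 \<pi> z \<le> 0" by (rule rc_le)
    then have "lam * reg_cost h \<pi>\<^sub>0 \<pi> z \<le> 0"
      using lam by (simp add: mult_nonneg_nonpos)
    then have "ennreal (g z) \<le> ennreal (1 + lam * (- reg_cost h \<pi>\<^sub>0 \<pi> z))"
      unfolding g_def using exp_neg_sum_le[of "lam * reg_cost h \<pi>\<^sub>0 \<pi> z" L] by (intro ennreal_leI) simp
    also have "\<dots> = 1 + ennreal lam * ennreal (- reg_cost h \<pi>\<^sub>0 \<pi> z)"
      using y lam by (subst ennreal_plus) (auto simp: mult_nonneg_nonpos simp flip: ennreal_mult)
    finally show "ennreal (g z) \<le> 1 + ennreal lam * ennreal (- reg_cost h \<pi>\<^sub>0 \<pi> z)" .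
  qed
  also have "\<dots> = 1 + ennreal lam * (\<integral>\<^sup>+z. ennreal (- reg_cost h \<pi>\<^sub>0 \<pi> z) \<partial>?Q)"
    using prob_space.emeasure_space_1[OF Q] by (simp add: nn_integral_add nn_integral_cmult)
  also have "\<dots> \<le> 1 + ennreal lam * ennreal (- ?R)"
    by (intro add_left_mono mult_left_mono nn_integral_neg_reg_cost_le[OF p \<nu> \<pi>\<^sub>0 \<pi> h h_ge]) simp
  also have "\<dots> = ennreal (1 + lam * (- ?R))"
    using R lam by (subst ennreal_plus) (auto simp: mult_nonneg_nonpos simp flip: ennreal_mult)
  finally have g: "(\<integral>\<^sup>+z. ennreal (g z) \<partial>?Q) \<le> ennreal (1 - lam * ?R)" by simp
  \<comment> \<open>The estimate under the logging law is pulled back to the probability space of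
    the data, where the Markov bound is applied.\<close>
  have "(\<integral>\<^sup>+\<omega>. ennreal (g (D i \<omega>)) \<partial>M) \<le> ennreal (1 - lam * ?R)" if i: "i \<in> {1..n}" for i
  proof -
    have [measurable]: "D i \<in> M \<rightarrow>\<^sub>M log_space X K"
      using indep i by (auto simp: indep_vars_def)
    have "(\<integral>\<^sup>+\<omega>. ennreal (g (D i \<omega>)) \<partial>M) = (\<integral>\<^sup>+z. ennreal (g z) \<partial>distr M (log_space X K) (D i))"
      by (simp add: nn_integral_distr)
    with law i g show ?thesis by simp
  qed
  moreover have "0 < 1 - lam * ?R"
    using lam R mult_nonneg_nonpos[of lam ?R] by linarith
  moreover have "indep_vars (\<lambda>_. borel) (\<lambda>i \<omega>. g (D i \<omega>)) {1..n}"
    by (rule indep_vars_compose2[OF indep]) measurable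
  ultimately have "1 - \<delta> \<le> prob {\<omega>\<in>space M. (\<Prod>i\<in>{1..n}. g (D i \<omega>)) \<le> (1 - lam * ?R) ^ card {1..n} / \<delta>}"
    using \<delta> by (intro prob_prod_le_ge) (auto simp: g_def)
  then show ?thesis
    unfolding risk_le_psi_iff[OF n L \<delta> lam R] by (simp add: g_def)
qed

end
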